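(* Let $N\ge1$ and $1<q<\infty$. There is a constant $C=C(q,N)$ depending only on $q$ and $N$ such that for every $u\in BMO(\mathbb{R}^N)$ (inequalities in $[0,\infty]$) $$\|u\|_{B^{1/q}_{q,\infty}(\mathbb{R}^N)}\le C\,[u]_{BV_w(\mathbb{R}^N)}^{\frac1q}\,\|u\|_{BMO(\mathbb{R}^N)}^{1-\frac1q}\le C\,\|u\|_{BV(\mathbb{R}^N)}^{\frac1q}\,\|u\|_{BMO(\mathbb{R}^N)}^{1-\frac1q}.$$ In particular, if $u\in BMO(\mathbb{R}^N)\cap BV_w(\mathbb{R}^N)$, then $u\in B^{1/q}_{q,\infty}(\mathbb{R}^N)$ for every $q\in(1,\infty)$.
   Context: $\mathcal{L}^N$ is Lebesgue measure; $0\cdot\infty:=0$. Define $[f]_{L^1_w(\mathbb{R}^N)}:=\sup_{t>0}t\,\mathcal{L}^N(\{|f|>t\})$; $L^1_w$ is the set of measurable $f$ for which this is finite. For measurable $u:\mathbb{R}^N\to\mathbb{R}$ put $$\|u\|_{BV(\mathbb{R}^N)}:=\sup_{h\ne0}\frac{\|u(\cdot+h)-u\|_{L^1(\mathbb{R}^N)}}{|h|},\qquad [u]_{BV_w(\mathbb{R}^N)}:=\sup_{h\ne0}\frac{[u(\cdot+h)-u]_{L^1_w(\mathbb{R}^N)}}{|h|};$$ $u\in BV(\mathbb{R}^N)$ iff $u\in L^1(\mathbb{R}^N)$ and $\|u\|_{BV(\mathbb{R}^N)}<\infty$; $u\in BV_w(\mathbb{R}^N)$ iff $u\in L^1_w(\mathbb{R}^N)$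 and $[u]_{BV_w(\mathbb{R}^N)}<\infty$. For $1<q<\infty$, $$\|u\|_{B^{1/q}_{q,\infty}(\mathbb{R}^N)}:=\sup_{t>0}\ t^{-1/q}\sup_{|h|\le t}\|u(\cdot+h)-u\|_{L^q(\mathbb{R}^N)}=\sup_{h\neq0}\frac{\|u(\cdot+h)-u\|_{L^q(\mathbb{R}^N)}}{|h|^{1/q}},$$ and $u\in B^{1/q}_{q,\infty}(\mathbb{R}^N)$ iff $u\in L^q(\mathbb{R}^N)$ and this is finite. A cube is a Cartesian product of $N$ non-empty closed bounded intervals of the same (positive) length. For real-valued $u\in L^1_{\mathrm{loc}}(\mathbb{R}^N)$, $u\in BMO(\mathbb{R}^N)$ means that $$\|u\|_{BMO(\mathbb{R}^N)}:=\sup\left\{\frac{1}{\mathcal{L}^N(C)^2}\int_C\int_C|u(z)-u(x)|\,dz\,dx : C\subset \mathbb{R}^N\text{ a cube}\right\}<\infty .$$ *)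

theory Defs
  imports "HOL-Analysis.Analysis"
begin

(* Power of an extended nonnegative real; only used with p > 0, where 0 and \<infinity> are fixed points. *)
definition ennpowr :: "ennreal \<Rightarrow> real \<Rightarrow> ennreal" where
  "ennpowr x p = (if x = \<infinity> then \<infinity> else ennreal (enn2real x powr p))"

definition Lp_norm :: "real \<Rightarrow> (real ^ 'n \<Rightarrow> real) \<Rightarrow> ennreal" where
  "Lp_norm p f = ennpowr (\<integral>\<^sup>+ x. ennreal (\<bar>f x\<bar> powr p) \<partial>lebesgue) (1 / p)"

definition Lp_space :: "real \<Rightarrow> (real ^ 'n \<Rightarrow> real) set" where
  "Lp_space p = {f. f \<in> borel_measurable lebesgue \<and> Lp_norm p f < \<infinity>}"

definition weak_L1_seminorm :: "(real ^ 'n \<Rightarrow> real) \<Rightarrow> ennreal" where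
  "weak_L1_seminorm f = (SUP t\<in>{0<..}. ennreal t * emeasure lebesgue {x. \<bar>f x\<bar> > t})"

definition weak_L1 :: "(real ^ 'n \<Rightarrow> real) set" where
  "weak_L1 = {f. f \<in> borel_measurable lebesgue \<and> weak_L1_seminorm f < \<infinity>}"

definition BV_norm :: "(real ^ 'n \<Rightarrow> real) \<Rightarrow> ennreal" where
  "BV_norm u = (SUP h\<in>-{0}. Lp_norm 1 (\<lambda>x. u (x + h) - u x) / ennreal (norm h))"

definition BVw_seminorm :: "(real ^ 'n \<Rightarrow> real) \<Rightarrow> ennreal" where
  "BVw_seminorm u = (SUP h\<in>-{0}. weak_L1_seminorm (\<lambda>x. u (x + h) - u x) / ennreal (norm h))"

definition BVw :: "(real ^ 'n \<Rightarrow> real) set" where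
  "BVw = {u. u \<in> weak_L1 \<and> BVw_seminorm u < \<infinity>}"

definition besov_norm :: "real \<Rightarrow> (real ^ 'n \<Rightarrow> real) \<Rightarrow> ennreal" where
  "besov_norm q u =
     (SUP t\<in>{0<..}. ennreal (t powr (- (1 / q))) *
        (SUP h\<in>{h. norm h \<le> t}. Lp_norm q (\<lambda>x. u (x + h) - u x)))"

definition besov_space :: "real \<Rightarrow> (real ^ 'n \<Rightarrow> real) set" where
  "besov_space q = {u. u \<in> Lp_space q \<and> besov_norm q u < \<infinity>}"

definition cubes :: "(real ^ 'n) set set" where
  "cubes = {cbox a b | a b. \<exists>l>0. \<forall>i. b $ i - a $ i = l}"

definition L1_loc :: "(real ^ 'n \<Rightarrow> real) set" where
  "L1_loc = {u. u \<in> borel_measurable lebesgue \<and>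
                (\<forall>K. compact K \<longrightarrow> set_integrable lebesgue K u)}"

definition BMO_norm :: "(real ^ 'n \<Rightarrow> real) \<Rightarrow> ennreal" where
  "BMO_norm u =
     (SUP C\<in>cubes. (\<integral>\<^sup>+ x\<in>C. (\<integral>\<^sup>+ z\<in>C. ennreal \<bar>u z - u x\<bar> \<partial>lebesgue) \<partial>lebesgue)
                    / (emeasure lebesgue C)\<^sup>2)"

definition BMO :: "(real ^ 'n \<Rightarrow> real) set" where
  "BMO = {u. u \<in> L1_loc \<and> BMO_norm u < \<infinity>}"

end

theory Submission
  imports Defs
begin

text \<open>
  For an increment \<open>g = u (\<cdot> + h) - u\<close> one interpolates \<open>L\<^sup>q\<close> between weak \<open>L\<^sup>1\<close> and BMO. The key
  point is that the superlevel measures \<open>D t = |{|g| > t}|\<close>, finite by the weak \<open>L\<^sup>1\<close> bound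
  \<open>D t \<le> A / t\<close>, satisfy \<open>D (t + s) \<le> D t / 2\<close> for \<open>s\<close> a dimensional multiple of a bound for the BMO
  norm of \<open>g\<close>. To see this, enclose \<open>{|g| > t}\<close> in an open set \<open>U\<close> of almost the same measure. Doubling
  the radius of a small ball around a point of \<open>U\<close>, stop just before \<open>U\<close> fills less than half of the
  ball; by Vitali's lemma one can choose disjoint stopping balls whose fivefold enlargements cover \<open>U\<close>.
  A definite portion of the cube around such an enlargement lies outside \<open>U\<close>, where \<open>|g| \<le> t\<close>, so the
  mean oscillation on this cube limits the measure of the part where \<open>|g| > t + s\<close>. Hence \<open>D\<close> decays
  exponentially beyond \<open>s\<close>, while \<open>D t \<le> A / t\<close> suffices below \<open>s\<close> because \<open>q > 1\<close>, and integrating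
  \<open>q * t powr (q - 1) * D t\<close> bounds the \<open>L\<^sup>q\<close> norm.
\<close>

section \<open>Vitali coverings by stopping balls\<close>

definition half_full :: "'a::euclidean_space set \<Rightarrow> 'a set \<Rightarrow> bool" where
  "half_full U B \<longleftrightarrow> measure lebesgue B \<le> 2 * measure lebesgue (B \<inter> U)"

definition stopping_balls :: "'a::euclidean_space set \<Rightarrow> ('a \<times> real) set" where
  "stopping_balls U =
     {(x, r). r > 0 \<and> half_full U (cball x r) \<and> \<not> half_full U (cball x (2 * r))}"

lemma stopping_radius_exists:
  fixes U :: "'a::euclidean_space set"
  assumes "open U" "U \<in> lmeasurable" "x \<in> U"
  obtains r where "(x, r) \<in> stopping_balls U"
proof -
  let ?\<mu> = "measure lebesgue" and ?N = "DIM('a)"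
  obtain e where e: "e > 0" "cball x e \<subseteq> U"
    using assms open_contains_cball by blast
  have vol: "?\<mu> (cball x (2 ^ k * e)) = unit_ball_vol ?N * e ^ ?N * (2 ^ k) ^ ?N" for k
    using e(1) by (simp add: content_cball power_mult_distrib)
  have "?\<mu> (cball x e) > 0"
    using vol[of 0] e(1) by simp
  hence full: "half_full U (cball x (2 ^ 0 * e))"
    using e(2) by (simp add: half_full_def Int_absorb2)
  obtain n where n: "2 * ?\<mu> U / (unit_ball_vol ?N * e ^ ?N) < 2 ^ n"
    using real_arch_pow[of 2] by auto
  have "2 * ?\<mu> (cball x (2 ^ n * e) \<inter> U) \<le> 2 * ?\<mu> U"
    using assms(2) by (auto intro!: measure_mono_fmeasurable)
  also have "\<dots> < unit_ball_vol ?N * e ^ ?N * 2 ^ n"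
    using n e(1) by (simp add: field_simps)
  also have "\<dots> \<le> ?\<mu> (cball x (2 ^ n * e))"
    unfolding vol using e(1) by (intro mult_left_mono self_le_power) auto
  finally have "\<not> half_full U (cball x (2 ^ n * e))"
    by (simp add: half_full_def)
  with full obtain k where "half_full U (cball x (2 ^ k * e))" "\<not> half_full U (cball x (2 ^ Suc k * e))"
    using ex_least_nat_less[of "\<lambda>k. \<not> half_full U (cball x (2 ^ k * e))" n] by blast
  with e(1) have "(x, 2 ^ k * e) \<in> stopping_balls U"
    by (simp add: stopping_balls_def mult.assoc)
  thus thesis
    by (rule that)
qed

lemma stopping_radius_bounded:
  fixes U :: "'a::euclidean_space set"
  assumes "U \<in> lmeasurable" "(x, r) \<in> stopping_balls U"
  shows "r \<le> max 1 (2 * measure lebesgue U / unit_ball_vol (DIM('a)))"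
proof (cases "r \<le> 1")
  case False
  have "unit_ball_vol (DIM('a)) * r \<le> unit_ball_vol (DIM('a)) * r ^ DIM('a)"
    using False by (intro mult_left_mono self_le_power) auto
  also have "\<dots> = measure lebesgue (cball x r)"
    using False by (simp add: content_cball)
  also have "\<dots> \<le> 2 * measure lebesgue (cball x r \<inter> U)"
    using assms(2) by (simp add: stopping_balls_def half_full_def)
  also have "\<dots> \<le> 2 * measure lebesgue U"
    using assms(1) by (auto intro!: measure_mono_fmeasurable)
  finally have "r \<le> 2 * measure lebesgue U / unit_ball_vol (DIM('a))"
    by (simp add: pos_le_divide_eq mult.commute)
  thus ?thesis
    by simp
qed simp

lemma Vitali_covering_stopping_balls:
  fixes U :: "'a::euclidean_space set"
  assumes "open U" "U \<in> lmeasurable"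
  obtains I where "countable I" "I \<subseteq> stopping_balls U"
    "pairwise (\<lambda>i j. disjnt (cball (fst i) (snd i)) (cball (fst j) (snd j))) I"
    "U \<subseteq> (\<Union>i\<in>I. cball (fst i) (5 * snd i))"
proof (rule Vitali_covering_lemma_cballs)
  show "U \<subseteq> (\<Union>i\<in>stopping_balls U. cball (fst i) (snd i))"
  proof
    fix x assume "x \<in> U"
    then obtain r where r: "(x, r) \<in> stopping_balls U"
      using stopping_radius_exists[OF assms] by blast
    moreover from r have "x \<in> cball x r"
      by (simp add: stopping_balls_def)
    ultimately show "x \<in> (\<Union>i\<in>stopping_balls U. cball (fst i) (snd i))"
      by force
  qed
  show "0 < snd i \<and> snd i \<le> max 1 (2 * measure lebesgue U / unit_ball_vol (DIM('a)))"
    if "i \<in> stopping_balls U" for i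
    using that stopping_radius_bounded[OF assms(2), of "fst i" "snd i"]
    by (auto simp: stopping_balls_def)
qed (rule that)

lemma measure_le_on_Vitali_cover:
  assumes I: "countable I" and E: "E \<in> sets M" "E \<subseteq> (\<Union>i\<in>I. A i)" and U: "U \<in> fmeasurable M"
    and A: "\<And>i. i \<in> I \<Longrightarrow> A i \<in> fmeasurable M" and B: "\<And>i. i \<in> I \<Longrightarrow> B i \<in> sets M"
    and disj: "pairwise (\<lambda>i j. disjnt (B i) (B j)) I" and c: "c \<ge> 0"
    and le: "\<And>i. i \<in> I \<Longrightarrow> measure M (E \<inter> A i) \<le> c * measure M (U \<inter> B i)"
  shows "measure M E \<le> c * measure M U"
proof -
  have "measure M (\<Union>i\<in>I. E \<inter> A i) \<le> c * measure M U"
  proof (rule measure_UN_bound[OF I])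
    show EA: "E \<inter> A i \<in> fmeasurable M" if "i \<in> I" for i
      using fmeasurable_Int_fmeasurable[OF A[OF that] E(1)] by (simp add: Int_commute)
    fix J assume J: "J \<subseteq> I" "finite J"
    have UB: "U \<inter> B i \<in> fmeasurable M" if "i \<in> J" for i
      using fmeasurable_Int_fmeasurable[OF U B] that J(1) by blast
    have UB_disj: "pairwise (\<lambda>i j. disjnt (U \<inter> B i) (U \<inter> B j)) J"
      using disj J(1) unfolding pairwise_def disjnt_def by blast
    have "measure M (\<Union>i\<in>J. E \<inter> A i) \<le> (\<Sum>i\<in>J. measure M (E \<inter> A i))"
      using J EA by (intro measure_UNION_le) auto
    also have "\<dots> \<le> (\<Sum>i\<in>J. c * measure M (U \<inter> B i))"
      using J by (intro sum_mono le) auto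
    also have "\<dots> = c * (\<Sum>i\<in>J. measure M (U \<inter> B i))"
      by (rule sum_distrib_left[symmetric])
    also have "(\<Sum>i\<in>J. measure M (U \<inter> B i)) = measure M (\<Union>i\<in>J. U \<inter> B i)"
      using J(2) UB UB_disj by (rule measure_UNION'[symmetric])
    also have "c * \<dots> \<le> c * measure M U"
      using J B U c
      by (intro mult_left_mono measure_mono_fmeasurable sets.finite_UN sets.Int) auto
    finally show "measure M (\<Union>i\<in>J. E \<inter> A i) \<le> c * measure M U" .
  qed
  moreover have "(\<Union>i\<in>I. E \<inter> A i) = E"
    using E(2) by blast
  ultimately show ?thesis
    by simp
qed

section \<open>Cubes\<close>

definition centered_cube :: "real ^ 'n \<Rightarrow> real \<Rightarrow> (real ^ 'n) set" where
  "centered_cube x r = cbox (\<chi> i. x $ i - r) (\<chi> i. x $ i + r)"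

lemma centered_cube_in_cubes:
  assumes "r > 0"
  shows "centered_cube x r \<in> cubes"
proof -
  have "(\<chi> i. x $ i + r) $ i - (\<chi> i. x $ i - r) $ i = 2 * r" for i
    by simp
  moreover have "2 * r > 0"
    using assms by simp
  ultimately show ?thesis
    unfolding centered_cube_def cubes_def by blast
qed

lemma cball_subset_centered_cube: "cball x r \<subseteq> centered_cube x r"
proof
  fix y assume "y \<in> cball x r"
  hence "\<bar>(y - x) $ i\<bar> \<le> r" for i
    using component_le_norm_cart[of "y - x" i] by (simp add: dist_norm norm_minus_commute)
  thus "y \<in> centered_cube x r"
    by (auto simp: centered_cube_def mem_box_cart abs_le_iff algebra_simps)
qed

lemma centered_cube_mono: "r \<le> s \<Longrightarrow> centered_cube x r \<subseteq> centered_cube x s"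
  unfolding centered_cube_def by (rule subset_interval_imp_cart(1)) simp

lemma fmeasurable_cube: "C \<in> cubes \<Longrightarrow> C \<in> lmeasurable"
  by (auto simp: cubes_def)

lemma measure_cube_pos:
  assumes "C \<in> cubes"
  shows "measure lebesgue C > 0"
proof -
  obtain a b l where C: "C = cbox a b" and l: "l > 0" "\<And>i. b $ i - a $ i = l"
    using assms unfolding cubes_def by blast
  have "a $ i < b $ i" for i
    using l(1) l(2)[of i] by linarith
  thus ?thesis
    unfolding C by (auto simp: content_pos_lt_eq Basis_vec_def inner_axis)
qed

lemma measure_centered_cube:
  fixes x :: "real ^ 'n"
  assumes "r \<ge> 0"
  shows "measure lebesgue (centered_cube x r) = (2 * r) ^ CARD('n)"
  using assms unfolding centered_cube_def
  by (simp add: content_cbox_cart interval_ne_empty_cart)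

lemma emeasure_cube_sq_neq:
  fixes C :: "(real ^ 'n) set"
  assumes "C \<in> cubes"
  shows "(emeasure lebesgue C)\<^sup>2 \<noteq> 0" "(emeasure lebesgue C)\<^sup>2 \<noteq> \<infinity>"
  using measure_cube_pos[OF assms] emeasure_eq_measure2[OF fmeasurable_cube[OF assms]]
  by (auto simp: ennreal_power)

lemma cubes_translation:
  assumes "C \<in> cubes"
  shows "(\<lambda>x. x + h) ` C \<in> cubes"
proof -
  obtain a b l where C: "C = cbox a b" and l: "l > 0" "\<forall>i. b $ i - a $ i = l"
    using assms unfolding cubes_def by blast
  have "(\<lambda>x. x + h) ` C = cbox (h + a) (h + b)"
    using cbox_translation[of h a b] by (simp add: C add.commute cong: image_cong_simp)
  moreover have "\<forall>i. (h + b) $ i - (h + a) $ i = l"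
    using l(2) by simp
  ultimately show ?thesis
    using l(1) unfolding cubes_def by blast
qed

section \<open>Lebesgue measure\<close>

lemma sigma_finite_lebesgue: "sigma_finite_measure lebesgue"
proof -
  obtain \<A> :: "'a set set" where \<A>: "countable \<A>" "\<A> \<subseteq> sets lborel" "\<Union>\<A> = space lborel"
      "\<forall>A\<in>\<A>. emeasure lborel A \<noteq> \<infinity>"
    using lborel.sigma_finite_countable by blast
  thus ?thesis
    by (intro sigma_finite_measure.intro exI[of _ \<A>]) auto
qed

interpretation lebesgue: sigma_finite_measure lebesgue
  by (rule sigma_finite_lebesgue)

lemma
  fixes h :: "'a::euclidean_space"
  shows measurable_lebesgue_translation [measurable]: "(\<lambda>x. x + h) \<in> lebesgue \<rightarrow>\<^sub>M lebesgue"
    and distr_lebesgue_translation: "distr lebesgue lebesgue (\<lambda>x. x + h) = lebesgue"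
proof -
  have T: "h + (\<Sum>j\<in>Basis. (1 * (x \<bullet> j)) *\<^sub>R j) = x + h" for x
    by (simp add: euclidean_representation add.commute)
  show "(\<lambda>x. x + h) \<in> lebesgue \<rightarrow>\<^sub>M lebesgue"
    using lebesgue_affine_measurable[of "\<lambda>_. 1" h] unfolding T by simp
  show "distr lebesgue lebesgue (\<lambda>x. x + h) = lebesgue"
    using lebesgue_affine_euclidean[of "\<lambda>_. 1" h] unfolding T by (simp add: density_1)
qed

lemma nn_integral_lebesgue_translation:
  fixes f :: "'a::euclidean_space \<Rightarrow> ennreal"
  assumes "f \<in> borel_measurable lebesgue"
  shows "(\<integral>\<^sup>+x. f (x + h) \<partial>lebesgue) = (\<integral>\<^sup>+x. f x \<partial>lebesgue)"
  using nn_integral_distr[OF measurable_lebesgue_translation[of h], of f] assms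
  by (simp add: distr_lebesgue_translation)

lemma AE_lebesgue_translation:
  fixes h :: "'a::euclidean_space"
  assumes "AE x in lebesgue. P x"
  shows "AE x in lebesgue. P (x + h)"
  by (rule AE_distrD[OF measurable_lebesgue_translation]) (simp only: distr_lebesgue_translation assms)

section \<open>Oscillation and BMO\<close>

definition oscillation :: "'a measure \<Rightarrow> ('a \<Rightarrow> real) \<Rightarrow> 'a set \<Rightarrow> ennreal" where
  "oscillation M u C = (\<integral>\<^sup>+x\<in>C. (\<integral>\<^sup>+z\<in>C. ennreal \<bar>u z - u x\<bar> \<partial>M) \<partial>M)"

lemma oscillation_ge_separated:
  assumes "P \<in> sets M" "D \<in> sets M" "P \<subseteq> C" "D \<subseteq> C"
    and sep: "\<And>x z. x \<in> P \<Longrightarrow> z \<in> D \<Longrightarrow> s \<le> \<bar>u z - u x\<bar>"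
  shows "ennreal s * emeasure M D * emeasure M P \<le> oscillation M u C"
proof -
  have inner: "ennreal s * emeasure M D \<le> (\<integral>\<^sup>+z\<in>C. ennreal \<bar>u z - u x\<bar> \<partial>M)" if "x \<in> P" for x
  proof -
    have "ennreal s * emeasure M D = (\<integral>\<^sup>+z. ennreal s * indicator D z \<partial>M)"
      using assms(2) by (simp add: nn_integral_cmult_indicator)
    also have "\<dots> \<le> (\<integral>\<^sup>+z\<in>C. ennreal \<bar>u z - u x\<bar> \<partial>M)"
      using sep[OF that] assms(4)
      by (intro nn_integral_mono) (auto simp: indicator_def intro!: ennreal_leI)
    finally show ?thesis .
  qed
  have "ennreal s * emeasure M D * emeasure M P = (\<integral>\<^sup>+x. ennreal s * emeasure M D * indicator P x \<partial>M)"
    using assms(1) by (simp add: nn_integral_cmult_indicator)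
  also have "\<dots> \<le> oscillation M u C"
    unfolding oscillation_def using inner assms(3)
    by (intro nn_integral_mono) (auto simp: indicator_def)
  finally show ?thesis .
qed

lemma (in sigma_finite_measure) oscillation_diff_le:
  assumes [measurable]: "u \<in> borel_measurable M" "v \<in> borel_measurable M" "C \<in> sets M"
  shows "oscillation M (\<lambda>x. u x - v x) C \<le> oscillation M u C + oscillation M v C"
proof -
  let ?I = "\<lambda>u x. \<integral>\<^sup>+z\<in>C. ennreal \<bar>u z - u x\<bar> \<partial>M"
  have inner: "?I (\<lambda>x. u x - v x) x \<le> ?I u x + ?I v x" for x
  proof -
    have "?I (\<lambda>x. u x - v x) x
        \<le> (\<integral>\<^sup>+z. ennreal \<bar>u z - u x\<bar> * indicator C z + ennreal \<bar>v z - v x\<bar> * indicator C z \<partial>M)"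
      by (intro nn_integral_mono)
        (auto simp: indicator_def ennreal_plus[symmetric] simp del: ennreal_plus intro!: ennreal_leI)
    also have "\<dots> = ?I u x + ?I v x"
      by (rule nn_integral_add) measurable
    finally show ?thesis .
  qed
  have "oscillation M (\<lambda>x. u x - v x) C \<le> (\<integral>\<^sup>+x. ?I u x * indicator C x + ?I v x * indicator C x \<partial>M)"
    unfolding oscillation_def distrib_right[symmetric]
    by (intro nn_integral_mono mult_right_mono inner) simp
  also have "\<dots> = oscillation M u C + oscillation M v C"
    unfolding oscillation_def by (rule nn_integral_add) measurable
  finally show ?thesis .
qed

lemma oscillation_translation:
  fixes u :: "'a::euclidean_space \<Rightarrow> real"
  assumes [measurable]: "u \<in> borel_measurable lebesgue" "(\<lambda>x. x + h) ` C \<in> sets lebesgue"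
  shows "oscillation lebesgue (\<lambda>x. u (x + h)) C = oscillation lebesgue u ((\<lambda>x. x + h) ` C)"
proof -
  let ?C = "(\<lambda>x. x + h) ` C"
  have ind: "indicator C x = (indicator ?C (x + h) :: ennreal)" for x
    by (auto simp: indicator_def)
  have inner: "(\<integral>\<^sup>+z\<in>C. ennreal \<bar>u (z + h) - c\<bar> \<partial>lebesgue)
      = (\<integral>\<^sup>+z\<in>?C. ennreal \<bar>u z - c\<bar> \<partial>lebesgue)" for c
    unfolding ind by (rule nn_integral_lebesgue_translation) measurable
  show ?thesis
    unfolding oscillation_def inner unfolding ind
    by (intro nn_integral_lebesgue_translation) measurable
qed

lemma divide_le_ennreal_iff:
  fixes a b c :: ennreal
  assumes "b \<noteq> 0" "b \<noteq> \<infinity>"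
  shows "a / b \<le> c \<longleftrightarrow> a \<le> c * b"
  using assms
  by (cases a; cases b; cases c)
     (auto simp: divide_ennreal ennreal_mult[symmetric] field_simps ennreal_top_mult ennreal_top_divide
        top_unique)

lemma BMO_norm_le_iff:
  "BMO_norm u \<le> b \<longleftrightarrow> (\<forall>C\<in>cubes. oscillation lebesgue u C \<le> b * (emeasure lebesgue C)\<^sup>2)"
proof -
  have "oscillation lebesgue u C / (emeasure lebesgue C)\<^sup>2 \<le> b
      \<longleftrightarrow> oscillation lebesgue u C \<le> b * (emeasure lebesgue C)\<^sup>2" if "C \<in> cubes" for C
    using emeasure_cube_sq_neq[OF that]
    by (intro divide_le_ennreal_iff)
  thus ?thesis
    unfolding BMO_norm_def SUP_le_iff oscillation_def by blast
qed

lemma BMO_norm_translation_le: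
  fixes u :: "real ^ 'n \<Rightarrow> real"
  assumes "u \<in> borel_measurable lebesgue"
  shows "BMO_norm (\<lambda>x. u (x + h)) \<le> BMO_norm u"
  unfolding BMO_norm_le_iff
proof
  fix C :: "(real ^ 'n) set" assume C: "C \<in> cubes"
  let ?C = "(\<lambda>x. x + h) ` C"
  have C': "?C \<in> cubes"
    using C by (rule cubes_translation)
  have "oscillation lebesgue (\<lambda>x. u (x + h)) C = oscillation lebesgue u ?C"
    using assms fmeasurable_cube[OF C'] by (intro oscillation_translation) auto
  also have "\<dots> \<le> BMO_norm u * (emeasure lebesgue ?C)\<^sup>2"
    using C' BMO_norm_le_iff[of u "BMO_norm u"] by blast
  also have "emeasure lebesgue ?C = emeasure lebesgue C"
    using emeasure_lebesgue_affine[of 1 h C] by (simp add: add.commute cong: image_cong_simp)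
  finally show "oscillation lebesgue (\<lambda>x. u (x + h)) C \<le> BMO_norm u * (emeasure lebesgue C)\<^sup>2" .
qed

lemma BMO_norm_diff_le:
  fixes u v :: "real ^ 'n \<Rightarrow> real"
  assumes "u \<in> borel_measurable lebesgue" "v \<in> borel_measurable lebesgue"
  shows "BMO_norm (\<lambda>x. u x - v x) \<le> BMO_norm u + BMO_norm v"
  unfolding BMO_norm_le_iff
proof
  fix C :: "(real ^ 'n) set" assume C: "C \<in> cubes"
  have "oscillation lebesgue (\<lambda>x. u x - v x) C \<le> oscillation lebesgue u C + oscillation lebesgue v C"
    using assms fmeasurable_cube[OF C] by (intro lebesgue.oscillation_diff_le) auto
  also have "\<dots> \<le> BMO_norm u * (emeasure lebesgue C)\<^sup>2 + BMO_norm v * (emeasure lebesgue C)\<^sup>2"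
    using C BMO_norm_le_iff[of u "BMO_norm u"] BMO_norm_le_iff[of v "BMO_norm v"]
    by (intro add_mono) auto
  finally show "oscillation lebesgue (\<lambda>x. u x - v x) C
      \<le> (BMO_norm u + BMO_norm v) * (emeasure lebesgue C)\<^sup>2"
    by (simp add: distrib_right)
qed

lemma BMO_norm_increment_le:
  fixes u :: "real ^ 'n \<Rightarrow> real"
  assumes [measurable]: "u \<in> borel_measurable lebesgue"
  shows "BMO_norm (\<lambda>x. u (x + h) - u x) \<le> 2 * BMO_norm u"
proof -
  have "BMO_norm (\<lambda>x. u (x + h) - u x) \<le> BMO_norm (\<lambda>x. u (x + h)) + BMO_norm u"
    by (rule BMO_norm_diff_le) measurable
  also have "\<dots> \<le> 2 * BMO_norm u"
    using BMO_norm_translation_le[OF assms] by (simp add: mult_2 add_right_mono)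
  finally show ?thesis .
qed

lemma (in sigma_finite_measure) AE_constant_on_if_oscillation_eq_0:
  assumes [measurable]: "u \<in> borel_measurable M" "C \<in> sets M" and "oscillation M u C = 0"
  shows "AE x\<in>C in M. AE z\<in>C in M. u z = u x"
proof -
  let ?I = "\<lambda>x. \<integral>\<^sup>+z\<in>C. ennreal \<bar>u z - u x\<bar> \<partial>M"
  have inner: "?I x = 0 \<longleftrightarrow> (AE z\<in>C in M. u z = u x)" for x
  proof -
    have "?I x = 0 \<longleftrightarrow> (AE z in M. ennreal \<bar>u z - u x\<bar> * indicator C z = 0)"
      by (rule nn_integral_0_iff_AE) measurable
    also have "\<dots> \<longleftrightarrow> (AE z\<in>C in M. u z = u x)"
      by (rule eventually_cong) (auto simp: indicator_def)
    finally show ?thesis .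
  qed
  have "(\<lambda>x. ?I x * indicator C x) \<in> borel_measurable M"
    by measurable
  from nn_integral_0_iff_AE[OF this] have "AE x in M. ?I x * indicator C x = 0"
    using assms(3) by (simp add: oscillation_def)
  thus ?thesis
    by eventually_elim (auto simp: inner)
qed

lemma (in sigma_finite_measure) AE_constant_if_oscillation_eq_0:
  assumes u: "u \<in> borel_measurable M"
    and "incseq C" and C: "\<And>n. C n \<in> sets M" "(\<Union>n. C n) = space M"
    and osc: "\<And>n :: nat. oscillation M u (C n) = 0"
  shows "AE x in M. AE z in M. u z = u x"
proof -
  have "AE x\<in>C n in M. AE z\<in>C n in M. u z = u x" for n
    by (rule AE_constant_on_if_oscillation_eq_0[OF u C(1) osc])
  hence "AE x in M. \<forall>n. x \<in> C n \<longrightarrow> (AE z\<in>C n in M. u z = u x)"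
    by (simp only: AE_all_countable simp_thms)
  with AE_space show ?thesis
  proof eventually_elim
    case (elim x)
    then obtain m where "x \<in> C m"
      using C(2) by blast
    hence "AE z\<in>C (max m n) in M. u z = u x" for n
      using elim(2) incseqD[OF \<open>incseq C\<close>, of m "max m n"] by auto
    hence "AE z in M. \<forall>n. z \<in> C (max m n) \<longrightarrow> u z = u x"
      by (simp only: AE_all_countable simp_thms)
    moreover have "\<exists>n. z \<in> C (max m n)" if "z \<in> space M" for z
    proof -
      from that obtain n where "z \<in> C n"
        using C(2) by blast
      thus ?thesis
        using incseqD[OF \<open>incseq C\<close>, of n "max m n"] by auto
    qed
    ultimately show ?case
      using AE_space[of M] by (auto elim: eventually_elim2)
  qed
qed

lemma UN_centered_cube: "(\<Union>n. centered_cube x (real (Suc n))) = UNIV"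
proof -
  have "\<exists>n. z \<in> centered_cube x (real (Suc n))" for z
  proof -
    obtain n where "dist x z \<le> real n"
      using real_arch_simple by blast
    hence "z \<in> cball x (real (Suc n))"
      by simp
    thus ?thesis
      using cball_subset_centered_cube by blast
  qed
  thus ?thesis
    by blast
qed

lemma AE_constant_if_BMO_norm_eq_0:
  fixes u :: "real ^ 'n \<Rightarrow> real"
  assumes "u \<in> borel_measurable lebesgue" "BMO_norm u = 0"
  obtains c where "AE x in lebesgue. u x = c"
proof -
  have Q: "centered_cube (0 :: real ^ 'n) (real (Suc n)) \<in> cubes" for n
    by (simp add: centered_cube_in_cubes)
  have "AE x in lebesgue. AE z in lebesgue. u z = u x"
  proof (rule lebesgue.AE_constant_if_oscillation_eq_0[OF assms(1)])
    show "incseq (\<lambda>n. centered_cube (0 :: real ^ 'n) (real (Suc n)))"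
      by (intro incseq_SucI centered_cube_mono) simp
    show "centered_cube (0 :: real ^ 'n) (real (Suc n)) \<in> sets lebesgue" for n
      using Q by (intro fmeasurableD fmeasurable_cube)
    show "(\<Union>n. centered_cube (0 :: real ^ 'n) (real (Suc n))) = space lebesgue"
      by (simp only: UN_centered_cube space_completion space_lborel space_borel)
    show "oscillation lebesgue u (centered_cube 0 (real (Suc n))) = 0" for n
      using BMO_norm_le_iff[of u 0] Q assms(2) by simp
  qed
  moreover have "ae_filter (lebesgue :: (real ^ 'n) measure) \<noteq> bot"
    by (simp add: ae_filter_eq_bot_iff)
  ultimately show thesis
    using eventually_happens'[of "ae_filter lebesgue"] that by blast
qed

section \<open>Decay of superlevel sets\<close>

lemma unit_ball_vol_neq_0 [simp]: "n \<ge> 0 \<Longrightarrow> unit_ball_vol n \<noteq> 0"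
  using unit_ball_vol_pos[of n] by force

text \<open>
  \<open>10 ^ n / unit_ball_vol n\<close> is the ratio of the volumes of a cube of side \<open>10 * r\<close> and a ball of
  radius \<open>r\<close>.
\<close>

definition decay_step :: "nat \<Rightarrow> real" where
  "decay_step n = 4 * (10 ^ n / unit_ball_vol n)\<^sup>2"

lemma decay_step_pos: "decay_step n > 0"
  by (simp add: decay_step_def)

lemma measure_outside_stopping_ball_ge:
  fixes U :: "'a::euclidean_space set"
  assumes "(x, r) \<in> stopping_balls U" "U \<in> sets lebesgue"
  shows "measure lebesgue (cball x r) \<le> measure lebesgue (cball x (2 * r) - U)"
proof -
  let ?\<mu> = "measure lebesgue" and ?B = "cball x (2 * r)"
  have r: "r > 0" and sparse: "2 * ?\<mu> (?B \<inter> U) \<le> ?\<mu> ?B"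
    using assms(1) by (auto simp: stopping_balls_def half_full_def)
  have "2 * r ^ DIM('a) \<le> (2 * r) ^ DIM('a)"
    using r by (simp add: power_mult_distrib self_le_power)
  hence "2 * ?\<mu> (cball x r) \<le> ?\<mu> ?B"
    using r mult_left_mono[of "2 * r ^ DIM('a)" "(2 * r) ^ DIM('a)" "unit_ball_vol (DIM('a))"]
    by (simp add: content_cball)
  with sparse have "?\<mu> (cball x r) \<le> ?\<mu> ?B - ?\<mu> (?B \<inter> U)"
    by linarith
  also have "\<dots> = ?\<mu> (?B - ?B \<inter> U)"
    using fmeasurable_Int_fmeasurable[OF lmeasurable_cball assms(2)]
    by (intro measurable_measure_Diff[symmetric]) auto
  also have "?B - ?B \<inter> U = ?B - U"
    by blast
  finally show ?thesis .
qed

lemma oscillation_ge_on_stopping_ball: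
  fixes g :: "real ^ 'n \<Rightarrow> real"
  assumes "(x, r) \<in> stopping_balls U" and sets: "U \<in> sets lebesgue" "E \<in> sets lebesgue" and "s \<ge> 0"
    and sep: "\<And>y z. y \<in> E \<Longrightarrow> z \<notin> U \<Longrightarrow> s \<le> \<bar>g z - g y\<bar>"
  shows "ennreal (s * measure lebesgue (cball x r) * measure lebesgue (E \<inter> cball x (5 * r)))
           \<le> oscillation lebesgue g (centered_cube x (5 * r))"
proof -
  let ?\<mu> = "measure lebesgue" and ?P = "E \<inter> cball x (5 * r)" and ?D = "cball x (2 * r) - U"
  have fm: "?P \<in> lmeasurable" "?D \<in> lmeasurable"
    using fmeasurable_Int_fmeasurable[OF lmeasurable_cball sets(2)]
      fmeasurable_Diff[OF lmeasurable_cball sets(1)]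
    by (simp_all only: Int_commute[of E])
  have "s * ?\<mu> (cball x r) * ?\<mu> ?P \<le> s * ?\<mu> ?D * ?\<mu> ?P"
    using assms(4) measure_outside_stopping_ball_ge[OF assms(1,2)]
    by (intro mult_right_mono mult_left_mono) auto
  hence "ennreal (s * ?\<mu> (cball x r) * ?\<mu> ?P) \<le> ennreal s * emeasure lebesgue ?D * emeasure lebesgue ?P"
    using fm assms(4) by (simp add: emeasure_eq_measure2 ennreal_mult[symmetric] ennreal_leI)
  also have "\<dots> \<le> oscillation lebesgue g (centered_cube x (5 * r))"
  proof (rule oscillation_ge_separated)
    have "cball x (2 * r) \<subseteq> cball x (5 * r)"
      using assms(1) by (intro subset_cball) (simp add: stopping_balls_def)
    thus "?P \<subseteq> centered_cube x (5 * r)" "?D \<subseteq> centered_cube x (5 * r)"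
      using cball_subset_centered_cube[of x "5 * r"] by blast+
  qed (use fm sep in auto)
  finally show ?thesis .
qed

lemma measure_on_stopping_ball_le:
  fixes g :: "real ^ 'n \<Rightarrow> real"
  assumes stop: "(x, r) \<in> stopping_balls U" and "U \<in> sets lebesgue" "E \<in> sets lebesgue"
    and B: "B > 0" "BMO_norm g \<le> ennreal B"
    and sep: "\<And>y z. y \<in> E \<Longrightarrow> z \<notin> U \<Longrightarrow> decay_step CARD('n) * B \<le> \<bar>g z - g y\<bar>"
  shows "measure lebesgue (E \<inter> cball x (5 * r)) \<le> 1 / 2 * measure lebesgue (U \<inter> cball x r)"
proof -
  let ?\<mu> = "measure lebesgue" and ?Q = "centered_cube x (5 * r)" and ?s = "decay_step CARD('n) * B"
  define \<kappa> where "\<kappa> = 10 ^ CARD('n) / unit_ball_vol CARD('n)"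
  have r: "r > 0" and full: "half_full U (cball x r)"
    using stop by (simp_all add: stopping_balls_def)
  have ball: "?\<mu> (cball x r) > 0"
    using r by (simp add: content_cball)
  have "?\<mu> ?Q = 10 ^ CARD('n) * r ^ CARD('n)"
    using r by (simp add: measure_centered_cube power_mult_distrib)
  hence Q: "?\<mu> ?Q = \<kappa> * ?\<mu> (cball x r)"
    using r by (simp add: content_cball \<kappa>_def)
  have "ennreal (?s * ?\<mu> (cball x r) * ?\<mu> (E \<inter> cball x (5 * r))) \<le> oscillation lebesgue g ?Q"
    by (rule oscillation_ge_on_stopping_ball[OF stop assms(2,3) _ sep])
      (use B(1) decay_step_pos[of "CARD('n)"] in auto)
  also have "\<dots> \<le> ennreal B * (emeasure lebesgue ?Q)\<^sup>2"
    using B(2) r unfolding BMO_norm_le_iff by (simp add: centered_cube_in_cubes)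
  also have "\<dots> = ennreal (B * (?\<mu> ?Q)\<^sup>2)"
    using B(1) r by (simp add: emeasure_eq_measure2 fmeasurable_cube centered_cube_in_cubes
        ennreal_mult ennreal_power)
  finally have "?s * ?\<mu> (cball x r) * ?\<mu> (E \<inter> cball x (5 * r)) \<le> B * (?\<mu> ?Q)\<^sup>2"
    using B(1) by simp
  hence "B * \<kappa>\<^sup>2 * ?\<mu> (cball x r) * (4 * ?\<mu> (E \<inter> cball x (5 * r)))
      \<le> B * \<kappa>\<^sup>2 * ?\<mu> (cball x r) * ?\<mu> (cball x r)"
    unfolding Q decay_step_def \<kappa>_def[symmetric]
    by (simp add: power_mult_distrib power2_eq_square mult_ac)
  moreover have "B * \<kappa>\<^sup>2 * ?\<mu> (cball x r) > 0"
    using B(1) ball by (simp add: \<kappa>_def)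
  ultimately have "4 * ?\<mu> (E \<inter> cball x (5 * r)) \<le> ?\<mu> (cball x r)"
    by (simp only: mult_le_cancel_left_pos)
  with full show ?thesis
    by (simp add: half_full_def Int_commute)
qed

lemma measure_le_half_open_if_separated:
  fixes g :: "real ^ 'n \<Rightarrow> real"
  assumes U: "open U" "U \<in> lmeasurable" and E: "E \<in> sets lebesgue" "E \<subseteq> U"
    and B: "B > 0" "BMO_norm g \<le> ennreal B"
    and sep: "\<And>y z. y \<in> E \<Longrightarrow> z \<notin> U \<Longrightarrow> decay_step CARD('n) * B \<le> \<bar>g z - g y\<bar>"
  shows "measure lebesgue E \<le> 1 / 2 * measure lebesgue U"
proof -
  obtain I where I: "countable I" "I \<subseteq> stopping_balls U"
    "pairwise (\<lambda>i j. disjnt (cball (fst i) (snd i)) (cball (fst j) (snd j))) I"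
    "U \<subseteq> (\<Union>i\<in>I. cball (fst i) (5 * snd i))"
    by (rule Vitali_covering_stopping_balls[OF U])
  show ?thesis
  proof (rule measure_le_on_Vitali_cover[OF I(1) E(1) _ U(2) _ _ I(3)])
    show "E \<subseteq> (\<Union>i\<in>I. cball (fst i) (5 * snd i))"
      using E(2) I(4) by blast
    show "measure lebesgue (E \<inter> cball (fst i) (5 * snd i))
        \<le> 1 / 2 * measure lebesgue (U \<inter> cball (fst i) (snd i))" if "i \<in> I" for i
      using that I(2) by (intro measure_on_stopping_ball_le[OF _ fmeasurableD[OF U(2)] E(1) B sep]) auto
  qed auto
qed

lemma measure_le_half_if_separated:
  fixes g :: "real ^ 'n \<Rightarrow> real"
  assumes E: "E \<in> sets lebesgue" "E \<subseteq> F" and F: "F \<in> lmeasurable"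
    and B: "B > 0" "BMO_norm g \<le> ennreal B"
    and sep: "\<And>y z. y \<in> E \<Longrightarrow> z \<notin> F \<Longrightarrow> decay_step CARD('n) * B \<le> \<bar>g z - g y\<bar>"
  shows "measure lebesgue E \<le> measure lebesgue F / 2"
proof (rule field_le_epsilon)
  fix \<delta> :: real assume "\<delta> > 0"
  obtain U where U: "open U" "F \<subseteq> U" "U - F \<in> lmeasurable" "emeasure lebesgue (U - F) < ennreal \<delta>"
    using sets_lebesgue_outer_open[OF fmeasurableD[OF F] \<open>\<delta> > 0\<close>] by blast
  have U_eq: "U = F \<union> (U - F)"
    using U(2) by blast
  have "U \<in> lmeasurable"
    using F U(3) by (subst U_eq) (rule fmeasurable.Un)
  hence "measure lebesgue E \<le> 1 / 2 * measure lebesgue U"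
    by (rule measure_le_half_open_if_separated[OF U(1) _ E(1) _ B sep]) (use E(2) U(2) in auto)
  also have "measure lebesgue U \<le> measure lebesgue F + measure lebesgue (U - F)"
    using F U(3) measure_Un_le[of F lebesgue "U - F"] U_eq by (simp add: fmeasurableD)
  also have "measure lebesgue (U - F) \<le> \<delta>"
    using U(3,4) \<open>\<delta> > 0\<close> by (simp add: emeasure_eq_measure2 ennreal_less_iff)
  finally show "measure lebesgue E \<le> measure lebesgue F / 2 + \<delta>"
    using \<open>\<delta> > 0\<close> by simp
qed

definition superlevel_measure :: "'a measure \<Rightarrow> ('a \<Rightarrow> real) \<Rightarrow> real \<Rightarrow> ennreal" where
  "superlevel_measure M f t = emeasure M {x \<in> space M. t < \<bar>f x\<bar>}"

lemma sets_superlevel: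
  "f \<in> borel_measurable M \<Longrightarrow> {x \<in> space M. t < \<bar>f x :: real\<bar>} \<in> sets M"
  by measurable

lemma superlevel_measure_halves:
  fixes g :: "real ^ 'n \<Rightarrow> real"
  assumes g: "g \<in> borel_measurable lebesgue" and B: "B > 0" "BMO_norm g \<le> ennreal B"
    and fin: "superlevel_measure lebesgue g t < \<infinity>"
  shows "superlevel_measure lebesgue g (t + decay_step CARD('n) * B)
           \<le> superlevel_measure lebesgue g t / 2"
proof -
  let ?s = "decay_step CARD('n) * B"
  define E where "E t = {x \<in> space lebesgue. t < \<bar>g x\<bar>}" for t
  have E_sets: "E t \<in> sets lebesgue" for t
    unfolding E_def using g by (rule sets_superlevel)
  have "?s > 0"
    using B(1) decay_step_pos by simp
  hence E_mono: "E (t + ?s) \<subseteq> E t"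
    by (auto simp: E_def)
  have E_fin: "E t \<in> lmeasurable"
    using E_sets fin by (simp add: fmeasurable_def superlevel_measure_def E_def)
  hence Es_fin: "E (t + ?s) \<in> lmeasurable"
    using E_mono E_sets by (rule fmeasurableI2)
  have "measure lebesgue (E (t + ?s)) \<le> measure lebesgue (E t) / 2"
  proof (rule measure_le_half_if_separated[OF E_sets E_mono E_fin B])
    show "?s \<le> \<bar>g z - g y\<bar>" if "y \<in> E (t + ?s)" "z \<notin> E t" for y z
      using that by (simp add: E_def)
  qed
  hence "ennreal (measure lebesgue (E (t + ?s))) \<le> ennreal (measure lebesgue (E t)) / 2"
    by (simp add: ennreal_divide_numeral ennreal_leI)
  thus ?thesis
    using E_fin Es_fin by (simp add: superlevel_measure_def E_def emeasure_eq_measure2)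
qed

lemma superlevel_measure_antimono:
  assumes "f \<in> borel_measurable M" "s \<le> t"
  shows "superlevel_measure M f t \<le> superlevel_measure M f s"
  unfolding superlevel_measure_def using assms by (intro emeasure_mono sets_superlevel) auto

lemma superlevel_measure_geometric_decay:
  assumes s: "s > 0" and a: "a \<ge> 0" and init: "superlevel_measure M f s \<le> ennreal a"
    and halves: "\<And>t. t \<ge> s \<Longrightarrow> superlevel_measure M f (t + s) \<le> superlevel_measure M f t / 2"
  shows "superlevel_measure M f ((real k + 1) * s) \<le> ennreal (a / 2 ^ k)"
proof (induction k)
  case 0
  show ?case
    using init by simp
next
  case (Suc k)
  have "superlevel_measure M f ((real (Suc k) + 1) * s) = superlevel_measure M f ((real k + 1) * s + s)"
    by (simp add: algebra_simps)
  also have "\<dots> \<le> superlevel_measure M f ((real k + 1) * s) / 2"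
    using s by (intro halves) simp
  also have "\<dots> \<le> ennreal (a / 2 ^ k) / 2"
    by (intro divide_right_mono_ennreal Suc.IH)
  also have "\<dots> = ennreal (a / 2 ^ Suc k)"
    using a by (simp add: ennreal_divide_numeral mult.commute)
  finally show ?case .
qed

lemma superlevel_measure_exponential_decay:
  assumes f: "f \<in> borel_measurable M" and s: "s > 0" and a: "a \<ge> 0"
    and init: "superlevel_measure M f s \<le> ennreal a"
    and halves: "\<And>t. t \<ge> s \<Longrightarrow> superlevel_measure M f (t + s) \<le> superlevel_measure M f t / 2"
    and t: "t \<ge> s"
  shows "superlevel_measure M f t \<le> ennreal (4 * a * exp (- (ln 2 / s * t)))"
proof -
  define k where "k = nat (\<lfloor>t / s\<rfloor> - 1)"
  have "t / s \<ge> 1"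
    using s t by simp
  hence "real k + 1 = of_int \<lfloor>t / s\<rfloor>"
    by (simp add: k_def)
  hence k: "real k + 1 \<le> t / s" "t / s - 2 \<le> real k"
    by linarith+
  have "superlevel_measure M f t \<le> superlevel_measure M f ((real k + 1) * s)"
    using k(1) s by (intro superlevel_measure_antimono f) (simp add: pos_le_divide_eq)
  also have "\<dots> \<le> ennreal (a / 2 ^ k)"
    by (rule superlevel_measure_geometric_decay[OF s a init halves])
  also have "a / 2 ^ k = a * 2 powr - real k"
    by (simp add: powr_minus powr_realpow divide_inverse)
  also have "\<dots> \<le> a * 2 powr (2 - t / s)"
    using a k(2) by (intro mult_left_mono powr_mono) auto
  also have "\<dots> = 4 * a * 2 powr - (t / s)"
    by (simp add: powr_diff powr_minus divide_inverse)
  also have "2 powr - (t / s) = exp (- (ln 2 / s * t))"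
    by (simp add: powr_def mult_ac)
  finally show ?thesis
    by (simp add: ennreal_leI)
qed

section \<open>Layer cake\<close>

lemma nn_integral_powr_from_0:
  fixes p c :: real
  assumes "p > 0" "c \<ge> 0"
  shows "(\<integral>\<^sup>+t\<in>{0..c}. ennreal (t powr (p - 1)) \<partial>lborel) = ennreal (c powr p / p)"
  using has_integral_powr_from_0[of "p - 1" c] assms
  by (intro nn_integral_has_integral_lebesgue') auto

lemma nn_integral_powr_exp_decay:
  fixes p a :: real
  assumes "p > 0" "a > 0"
  shows "(\<integral>\<^sup>+t\<in>{0..}. ennreal (t powr (p - 1) * exp (- (a * t))) \<partial>lborel)
           = ennreal (Gamma p / a powr p)"
proof -
  let ?f = "\<lambda>t :: real. ennreal (t powr (p - 1) * exp (- (a * t))) * indicator {0..} t"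
  have f: "?f (0 + 1 / a * t)
      = ennreal (a powr (1 - p)) * ennreal (indicator {0..} t * t powr (p - 1) / exp t)" for t
    using assms
    by (auto simp: indicator_def zero_le_divide_iff powr_divide powr_diff exp_minus field_simps
        ennreal_mult[symmetric])
  have "(\<integral>\<^sup>+t. ?f t \<partial>lborel) = ennreal \<bar>1 / a\<bar> * (\<integral>\<^sup>+t. ?f (0 + 1 / a * t) \<partial>lborel)"
    using assms by (intro nn_integral_real_affine) auto
  also have "\<dots> = ennreal (1 / a) * (ennreal (a powr (1 - p)) * ennreal (Gamma p))"
    unfolding f using assms by (simp add: nn_integral_cmult Gamma_conv_nn_integral_real)
  also have "\<dots> = ennreal (Gamma p / a powr p)"
    using assms by (simp add: ennreal_mult[symmetric] powr_diff less_imp_le)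
  finally show ?thesis .
qed

lemma (in sigma_finite_measure) nn_integral_powr_layer_cake:
  fixes f :: "'a \<Rightarrow> real"
  assumes [measurable]: "f \<in> borel_measurable M" and "p > 0"
  shows "(\<integral>\<^sup>+x. ennreal (\<bar>f x\<bar> powr p) \<partial>M)
           = (\<integral>\<^sup>+t\<in>{0..}. ennreal (p * t powr (p - 1)) * superlevel_measure M f t \<partial>lborel)"
proof -
  interpret pair: pair_sigma_finite lborel M ..
  let ?w = "\<lambda>t. ennreal (p * t powr (p - 1)) * indicator {0..} t"
  have slice: "ennreal (\<bar>f x\<bar> powr p) = (\<integral>\<^sup>+t. ?w t * indicator {t. t < \<bar>f x\<bar>} t \<partial>lborel)" for x
  proof -
    have "ennreal (\<bar>f x\<bar> powr p) = ennreal p * (\<integral>\<^sup>+t\<in>{0..\<bar>f x\<bar>}. ennreal (t powr (p - 1)) \<partial>lborel)"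
      using assms(2) by (simp add: nn_integral_powr_from_0 ennreal_mult[symmetric])
    also have "\<dots> = (\<integral>\<^sup>+t. ennreal p * (ennreal (t powr (p - 1)) * indicator {0..\<bar>f x\<bar>} t) \<partial>lborel)"
      by (rule nn_integral_cmult[symmetric]) measurable
    also have "\<dots> = (\<integral>\<^sup>+t. ?w t * indicator {t. t < \<bar>f x\<bar>} t \<partial>lborel)"
    proof (rule nn_integral_cong_AE)
      show "AE t in lborel. ennreal p * (ennreal (t powr (p - 1)) * indicator {0..\<bar>f x\<bar>} t)
          = ?w t * indicator {t. t < \<bar>f x\<bar>} t"
        by (rule eventually_mono[OF AE_lborel_singleton[of "\<bar>f x\<bar>"]])
          (use assms(2) in \<open>auto simp: indicator_def ennreal_mult\<close>)
    qed
    finally show ?thesis .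
  qed
  have layer: "(\<integral>\<^sup>+x. ?w t * indicator {t. t < \<bar>f x\<bar>} t \<partial>M) = ?w t * superlevel_measure M f t" for t
  proof -
    have "(\<integral>\<^sup>+x. ?w t * indicator {t. t < \<bar>f x\<bar>} t \<partial>M)
        = (\<integral>\<^sup>+x. ?w t * indicator {x \<in> space M. t < \<bar>f x\<bar>} x \<partial>M)"
      by (intro nn_integral_cong) (auto simp: indicator_def)
    also have "\<dots> = ?w t * superlevel_measure M f t"
      unfolding superlevel_measure_def by (rule nn_integral_cmult_indicator) measurable
    finally show ?thesis .
  qed
  have "(\<integral>\<^sup>+x. ennreal (\<bar>f x\<bar> powr p) \<partial>M) = (\<integral>\<^sup>+t. (\<integral>\<^sup>+x. ?w t * indicator {t. t < \<bar>f x\<bar>} t \<partial>M) \<partial>lborel)"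
    unfolding slice by (rule pair.Fubini') measurable
  thus ?thesis
    unfolding layer by (simp only: mult_ac)
qed

definition layer_cake_const :: "real \<Rightarrow> real" where
  "layer_cake_const p = p / (p - 1) + 4 * Gamma (p + 1) / ln 2 powr p"

lemma layer_cake_const_pos: "p > 1 \<Longrightarrow> layer_cake_const p > 0"
  unfolding layer_cake_const_def by (intro add_pos_nonneg) (auto intro!: less_imp_le)

context
  fixes M :: "'a measure" and f :: "'a \<Rightarrow> real" and s a p :: real
  assumes f [measurable]: "f \<in> borel_measurable M" and s: "s > 0" and a: "a \<ge> 0" and p: "p > 1"
    and weak: "\<And>t. t > 0 \<Longrightarrow> superlevel_measure M f t \<le> ennreal (a / t)"
    and halves: "\<And>t. t > 0 \<Longrightarrow> superlevel_measure M f (t + s) \<le> superlevel_measure M f t / 2"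
begin

lemma superlevel_measure_le_weak_or_exponential:
  assumes t: "t > 0"
  shows "superlevel_measure M f t
           \<le> ennreal (a / t) * indicator {0..s} t + ennreal (4 * (a / s) * exp (- (ln 2 / s * t)))"
proof (cases "t \<le> s")
  case True
  with weak[OF t] t show ?thesis
    by (simp add: add_increasing2)
next
  case False
  have "superlevel_measure M f t \<le> ennreal (4 * (a / s) * exp (- (ln 2 / s * t)))"
    using f s a weak halves False by (intro superlevel_measure_exponential_decay) auto
  thus ?thesis
    by (simp add: add_increasing)
qed

lemma layer_le_weak_or_exponential:
  "ennreal (p * t powr (p - 1)) * superlevel_measure M f t * indicator {0..} t
     \<le> ennreal (p * a) * (ennreal (t powr (p - 1 - 1)) * indicator {0..s} t)
       + ennreal (4 * p * a / s) *
           (ennreal (t powr (p - 1) * exp (- (ln 2 / s * t))) * indicator {0..} t)"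
  (is "?w * ?D * _ \<le> ?low + ?high")
proof (cases "t > 0")
  case True
  let ?e = "ennreal (4 * (a / s) * exp (- (ln 2 / s * t)))"
  have "?w * ?D \<le> ?w * (ennreal (a / t) * indicator {0..s} t + ?e)"
    using superlevel_measure_le_weak_or_exponential[OF True] by (rule mult_left_mono) simp
  also have "\<dots> = (?w * ennreal (a / t)) * indicator {0..s} t + ?w * ?e"
    by (simp add: distrib_left mult.assoc)
  also have "?w * ennreal (a / t) = ennreal (p * a) * ennreal (t powr (p - 1 - 1))"
    using True p a by (simp add: ennreal_mult[symmetric] powr_diff power2_eq_square)
  also have "?w * ?e = ?high"
    using True p s a by (simp add: ennreal_mult[symmetric] mult_ac)
  finally show ?thesis
    using True by (simp add: mult.assoc)
qed (use p in \<open>auto simp: indicator_def\<close>)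

lemma nn_integral_powr_le_if_weak_L1_and_halving:
  assumes "sigma_finite_measure M"
  shows "(\<integral>\<^sup>+x. ennreal (\<bar>f x\<bar> powr p) \<partial>M) \<le> ennreal (layer_cake_const p * a * s powr (p - 1))"
proof -
  let ?low = "\<lambda>t. ennreal (p * a) * (ennreal (t powr (p - 1 - 1)) * indicator {0..s} t)"
  let ?high = "\<lambda>t. ennreal (4 * p * a / s) *
    (ennreal (t powr (p - 1) * exp (- (ln 2 / s * t))) * indicator {0..} t)"
  have low: "(\<integral>\<^sup>+t. ?low t \<partial>lborel) = ennreal (p / (p - 1) * a * s powr (p - 1))"
    using nn_integral_powr_from_0[of "p - 1" s] p s a
    by (simp add: nn_integral_cmult ennreal_mult[symmetric] mult_ac)
  have "Gamma (p + 1) = p * Gamma p"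
    using p by (intro Gamma_plus1) (auto elim!: nonpos_Ints_cases)
  hence "4 * p * a / s * (Gamma p / (ln 2 / s) powr p)
      = 4 * Gamma (p + 1) / ln 2 powr p * a * s powr (p - 1)"
    using p s by (simp add: powr_divide powr_diff mult_ac)
  hence high: "(\<integral>\<^sup>+t. ?high t \<partial>lborel) = ennreal (4 * Gamma (p + 1) / ln 2 powr p * a * s powr (p - 1))"
    using nn_integral_powr_exp_decay[of p "ln 2 / s"] p s a
    by (simp add: nn_integral_cmult ennreal_mult[symmetric] less_imp_le)
  have "(\<integral>\<^sup>+x. ennreal (\<bar>f x\<bar> powr p) \<partial>M)
      = (\<integral>\<^sup>+t\<in>{0..}. ennreal (p * t powr (p - 1)) * superlevel_measure M f t \<partial>lborel)"
    using assms f p by (intro sigma_finite_measure.nn_integral_powr_layer_cake) auto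
  also have "\<dots> \<le> (\<integral>\<^sup>+t. ?low t + ?high t \<partial>lborel)"
    by (intro nn_integral_mono layer_le_weak_or_exponential)
  also have "\<dots> = (\<integral>\<^sup>+t. ?low t \<partial>lborel) + (\<integral>\<^sup>+t. ?high t \<partial>lborel)"
    by (rule nn_integral_add) measurable
  also have "\<dots> = ennreal (layer_cake_const p * a * s powr (p - 1))"
    unfolding low high using p a
    by (simp add: layer_cake_const_def ennreal_plus[symmetric] less_imp_le distrib_right
        del: ennreal_plus)
  finally show ?thesis .
qed

end

section \<open>The interpolation inequality\<close>

lemma ennpowr_ennreal: "x \<ge> 0 \<Longrightarrow> ennpowr (ennreal x) p = ennreal (x powr p)"
  by (simp add: ennpowr_def)

lemma ennpowr_mono:
  assumes "x \<le> y" "p \<ge> 0"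
  shows "ennpowr x p \<le> ennpowr y p"
proof (cases "y = \<infinity>")
  case False
  with assms have "x \<noteq> \<infinity>" "enn2real x \<le> enn2real y"
    by (auto simp: top_unique less_top enn2real_mono)
  with False assms show ?thesis
    by (auto simp: ennpowr_def intro!: ennreal_leI powr_mono2)
qed (simp add: ennpowr_def)

lemma weak_L1_seminorm_eq:
  "weak_L1_seminorm f = (SUP t\<in>{0<..}. ennreal t * superlevel_measure lebesgue f t)"
  by (simp add: weak_L1_seminorm_def superlevel_measure_def)

lemma superlevel_measure_le_weak_L1:
  assumes "weak_L1_seminorm f \<le> ennreal a" "t > 0"
  shows "superlevel_measure lebesgue f t \<le> ennreal (a / t)"
proof -
  have "ennreal t * superlevel_measure lebesgue f t \<le> weak_L1_seminorm f"
    unfolding weak_L1_seminorm_eq by (rule SUP_upper) (use assms(2) in simp)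
  also note assms(1)
  finally have "superlevel_measure lebesgue f t * ennreal t / ennreal t \<le> ennreal a / ennreal t"
    by (intro divide_right_mono_ennreal) (simp add: mult.commute)
  thus ?thesis
    using assms(2) by (cases "a \<ge> 0") (simp_all add: ennreal_mult_divide_eq divide_ennreal ennreal_neg)
qed

lemma weak_L1_seminorm_le_Lp_norm_1:
  fixes f :: "real ^ 'n \<Rightarrow> real"
  assumes f: "f \<in> borel_measurable lebesgue"
  shows "weak_L1_seminorm f \<le> Lp_norm 1 f"
proof -
  have Lp: "Lp_norm 1 f = (\<integral>\<^sup>+x. ennreal \<bar>f x\<bar> \<partial>lebesgue)"
    by (simp add: Lp_norm_def ennpowr_def less_top)
  have "ennreal t * superlevel_measure lebesgue f t \<le> (\<integral>\<^sup>+x. ennreal \<bar>f x\<bar> \<partial>lebesgue)" for t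
  proof -
    have "ennreal t * superlevel_measure lebesgue f t
        = (\<integral>\<^sup>+x. ennreal t * indicator {x \<in> space lebesgue. t < \<bar>f x\<bar>} x \<partial>lebesgue)"
      unfolding superlevel_measure_def
      by (rule nn_integral_cmult_indicator[symmetric]) (rule sets_superlevel[OF f])
    also have "\<dots> \<le> (\<integral>\<^sup>+x. ennreal \<bar>f x\<bar> \<partial>lebesgue)"
      by (intro nn_integral_mono) (auto simp: indicator_def intro!: ennreal_leI)
    finally show ?thesis .
  qed
  thus ?thesis
    unfolding weak_L1_seminorm_eq Lp by (intro SUP_least)
qed

definition Lq_interpolation_const :: "real \<Rightarrow> nat \<Rightarrow> real" where
  "Lq_interpolation_const q n = (layer_cake_const q * decay_step n powr (q - 1)) powr (1 / q)"

lemma Lq_interpolation_const_pos: "q > 1 \<Longrightarrow> Lq_interpolation_const q n > 0"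
  using layer_cake_const_pos[of q] decay_step_pos[of n] by (simp add: Lq_interpolation_const_def)

lemma Lp_norm_le_weak_L1_BMO:
  fixes f :: "real ^ 'n \<Rightarrow> real"
  assumes f: "f \<in> borel_measurable lebesgue" and q: "q > 1" and a: "a \<ge> 0" and b: "b > 0"
    and weak: "weak_L1_seminorm f \<le> ennreal a" and BMO: "BMO_norm f \<le> ennreal b"
  shows "Lp_norm q f
    \<le> ennreal (Lq_interpolation_const q CARD('n) * a powr (1 / q) * b powr (1 - 1 / q))"
proof -
  let ?s = "decay_step CARD('n)" and ?K = "layer_cake_const q"
  have pos: "?s > 0" "?K > 0"
    using q by (simp_all add: decay_step_pos layer_cake_const_pos)
  have "(\<integral>\<^sup>+x. ennreal (\<bar>f x\<bar> powr q) \<partial>lebesgue) \<le> ennreal (?K * a * (?s * b) powr (q - 1))"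
  proof (rule nn_integral_powr_le_if_weak_L1_and_halving[OF f _ a q _ _ sigma_finite_lebesgue])
    fix t :: real assume "t > 0"
    with weak show le: "superlevel_measure lebesgue f t \<le> ennreal (a / t)"
      by (rule superlevel_measure_le_weak_L1)
    show "superlevel_measure lebesgue f (t + ?s * b) \<le> superlevel_measure lebesgue f t / 2"
      using le_less_trans[OF le] by (intro superlevel_measure_halves f b BMO) simp
  qed (use pos b in simp)
  hence "Lp_norm q f \<le> ennpowr (ennreal (?K * a * (?s * b) powr (q - 1))) (1 / q)"
    unfolding Lp_norm_def using q by (intro ennpowr_mono) auto
  also have "\<dots> = ennreal ((?K * a * (?s * b) powr (q - 1)) powr (1 / q))"
    using a pos by (intro ennpowr_ennreal) auto
  also have "(?K * a * (?s * b) powr (q - 1)) powr (1 / q)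
      = (?K * ?s powr (q - 1)) powr (1 / q) * a powr (1 / q) * (b powr (q - 1)) powr (1 / q)"
    using a b pos by (simp add: powr_mult mult_ac)
  also have "(b powr (q - 1)) powr (1 / q) = b powr (1 - 1 / q)"
    using q by (simp add: powr_powr diff_divide_distrib)
  finally show ?thesis
    by (simp add: Lq_interpolation_const_def)
qed

lemma Lp_space_if_weak_L1_BMO:
  fixes u :: "real ^ 'n \<Rightarrow> real"
  assumes q: "q > 1" and u: "u \<in> weak_L1" "u \<in> BMO"
  shows "u \<in> Lp_space q"
proof -
  have meas: "u \<in> borel_measurable lebesgue"
    using u(1) by (simp add: weak_L1_def)
  obtain a where a: "weak_L1_seminorm u = ennreal a" "a \<ge> 0"
    using u(1) by (cases "weak_L1_seminorm u") (auto simp: weak_L1_def)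
  obtain b where b: "BMO_norm u = ennreal b" "b \<ge> 0"
    using u(2) by (cases "BMO_norm u") (auto simp: BMO_def)
  have "BMO_norm u \<le> ennreal (b + 1)"
    using b by (simp add: ennreal_leI)
  from Lp_norm_le_weak_L1_BMO[OF meas q a(2) _ _ this]
  have "Lp_norm q u
      \<le> ennreal (Lq_interpolation_const q CARD('n) * a powr (1 / q) * (b + 1) powr (1 - 1 / q))"
    using a b by simp
  hence "Lp_norm q u < \<infinity>"
    by (rule le_less_trans) simp
  with meas show ?thesis
    by (simp add: Lp_space_def)
qed

lemma BVw_seminorm_le_BV_norm:
  fixes u :: "real ^ 'n \<Rightarrow> real"
  assumes [measurable]: "u \<in> borel_measurable lebesgue"
  shows "BVw_seminorm u \<le> BV_norm u"
  unfolding BVw_seminorm_def BV_norm_def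
  by (intro SUP_mono' divide_right_mono_ennreal weak_L1_seminorm_le_Lp_norm_1) measurable

lemma weak_L1_seminorm_increment_le:
  fixes u :: "real ^ 'n \<Rightarrow> real"
  shows "weak_L1_seminorm (\<lambda>x. u (x + h) - u x) \<le> BVw_seminorm u * ennreal (norm h)"
proof (cases "h = 0")
  case False
  have "weak_L1_seminorm (\<lambda>x. u (x + h) - u x) / ennreal (norm h) \<le> BVw_seminorm u"
    unfolding BVw_seminorm_def by (rule SUP_upper) (use False in auto)
  with False show ?thesis
    by (simp add: divide_le_ennreal_iff)
qed (auto simp: weak_L1_seminorm_def)

lemma besov_norm_le:
  fixes u :: "real ^ 'n \<Rightarrow> real"
  assumes "q > 0"
    and incr: "\<And>h. Lp_norm q (\<lambda>x. u (x + h) - u x) \<le> ennreal (norm h powr (1 / q)) * K"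
  shows "besov_norm q u \<le> K"
  unfolding besov_norm_def
proof (rule SUP_least)
  fix t :: real assume "t \<in> {0<..}"
  hence t: "ennreal (t powr - (1 / q)) * ennreal (t powr (1 / q)) = 1"
    by (simp add: ennreal_mult[symmetric] powr_add[symmetric])
  have "Lp_norm q (\<lambda>x. u (x + h) - u x) \<le> ennreal (t powr (1 / q)) * K" if "norm h \<le> t" for h
  proof -
    have "norm h powr (1 / q) \<le> t powr (1 / q)"
      using that assms(1) by (intro powr_mono2) auto
    thus ?thesis
      using incr[of h] by (meson ennreal_leI mult_right_mono order_trans zero_le)
  qed
  hence "(SUP h\<in>{h. norm h \<le> t}. Lp_norm q (\<lambda>x. u (x + h) - u x)) \<le> ennreal (t powr (1 / q)) * K"
    by (intro SUP_least) auto
  hence "ennreal (t powr - (1 / q)) * (SUP h\<in>{h. norm h \<le> t}. Lp_norm q (\<lambda>x. u (x + h) - u x))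
      \<le> ennreal (t powr - (1 / q)) * (ennreal (t powr (1 / q)) * K)"
    by (rule mult_left_mono) simp
  also have "\<dots> = K"
    by (simp add: mult.assoc[symmetric] t)
  finally show "ennreal (t powr - (1 / q)) *
      (SUP h\<in>{h. norm h \<le> t}. Lp_norm q (\<lambda>x. u (x + h) - u x)) \<le> K" .
qed

lemma Lp_norm_eq_0:
  fixes f :: "real ^ 'n \<Rightarrow> real"
  assumes "AE x in lebesgue. f x = 0"
  shows "Lp_norm p f = 0"
proof -
  have "(\<integral>\<^sup>+x. ennreal (\<bar>f x\<bar> powr p) \<partial>lebesgue) = (\<integral>\<^sup>+(x :: real ^ 'n). 0 \<partial>lebesgue)"
    by (rule nn_integral_cong_AE) (use assms in \<open>auto elim: eventually_mono\<close>)
  thus ?thesis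
    by (simp add: Lp_norm_def ennpowr_def)
qed

lemma besov_norm_eq_0:
  fixes u :: "real ^ 'n \<Rightarrow> real"
  assumes "q > 0" "AE x in lebesgue. u x = c"
  shows "besov_norm q u = 0"
proof -
  have "Lp_norm q (\<lambda>x. u (x + h) - u x) = 0" for h
  proof (rule Lp_norm_eq_0)
    show "AE x in lebesgue. u (x + h) - u x = 0"
      using AE_lebesgue_translation[OF assms(2), of h] assms(2) by eventually_elim simp
  qed
  hence "besov_norm q u \<le> 0"
    using assms(1) by (intro besov_norm_le) auto
  thus ?thesis
    by simp
qed

definition besov_interpolation_const :: "real \<Rightarrow> nat \<Rightarrow> real" where
  "besov_interpolation_const q n = Lq_interpolation_const q n * 2 powr (1 - 1 / q)"

lemma besov_interpolation_const_pos: "q > 1 \<Longrightarrow> besov_interpolation_const q n > 0"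
  using Lq_interpolation_const_pos[of q n] by (simp add: besov_interpolation_const_def)

lemma besov_norm_le_finite_BVw_BMO:
  fixes u :: "real ^ 'n \<Rightarrow> real"
  assumes q: "q > 1" and u [measurable]: "u \<in> borel_measurable lebesgue"
    and a: "BVw_seminorm u = ennreal a" "a \<ge> 0" and b: "BMO_norm u = ennreal b" "b > 0"
  shows "besov_norm q u
    \<le> ennreal (besov_interpolation_const q CARD('n) * a powr (1 / q) * b powr (1 - 1 / q))"
    (is "_ \<le> ennreal ?X")
proof (rule besov_norm_le)
  fix h :: "real ^ 'n"
  let ?K = "Lq_interpolation_const q CARD('n)"
  have "Lp_norm q (\<lambda>x. u (x + h) - u x)
      \<le> ennreal (?K * (a * norm h) powr (1 / q) * (2 * b) powr (1 - 1 / q))"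
  proof (rule Lp_norm_le_weak_L1_BMO)
    show "weak_L1_seminorm (\<lambda>x. u (x + h) - u x) \<le> ennreal (a * norm h)"
      using weak_L1_seminorm_increment_le[of u h] a by (simp add: ennreal_mult)
    show "BMO_norm (\<lambda>x. u (x + h) - u x) \<le> ennreal (2 * b)"
      using BMO_norm_increment_le[OF u, of h] b by (simp add: ennreal_mult)
  qed (use q a b in \<open>auto intro!: borel_measurable_diff\<close>)
  also have "?K * (a * norm h) powr (1 / q) * (2 * b) powr (1 - 1 / q)
      = norm h powr (1 / q) * ?X"
    using a b by (simp add: besov_interpolation_const_def powr_mult mult_ac)
  finally show "Lp_norm q (\<lambda>x. u (x + h) - u x) \<le> ennreal (norm h powr (1 / q)) * ennreal ?X"
    using besov_interpolation_const_pos[OF q, of "CARD('n)"] by (simp add: ennreal_mult)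
qed (use q in simp)

lemma besov_norm_le_BVw_BMO:
  fixes u :: "real ^ 'n \<Rightarrow> real"
  assumes q: "q > 1" and u: "u \<in> BMO"
  shows "besov_norm q u \<le> ennreal (besov_interpolation_const q CARD('n)) *
    ennpowr (BVw_seminorm u) (1 / q) * ennpowr (BMO_norm u) (1 - 1 / q)"
    (is "_ \<le> ennreal ?K * _ * _")
proof -
  have meas: "u \<in> borel_measurable lebesgue"
    using u by (simp add: BMO_def L1_loc_def)
  have K: "?K > 0"
    using q by (rule besov_interpolation_const_pos)
  obtain b where b: "BMO_norm u = ennreal b" "b \<ge> 0"
    using u by (cases "BMO_norm u") (auto simp: BMO_def)
  consider "b = 0" | "b > 0" "BVw_seminorm u = \<infinity>" | a where "b > 0" "BVw_seminorm u = ennreal a" "a \<ge> 0"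
    using b(2) by (cases "BVw_seminorm u") (auto simp: less_eq_real_def)
  thus ?thesis
  proof cases
    case 1 \<comment> \<open>here \<open>BVw_seminorm u\<close> may be infinite, and the right-hand side is still \<open>\<infinity> * 0 = 0\<close>\<close>
    with b obtain c where "AE x in lebesgue. u x = c"
      using AE_constant_if_BMO_norm_eq_0[OF meas] by auto
    with q show ?thesis
      by (simp add: besov_norm_eq_0)
  next
    case 2
    with K have "ennreal ?K * ennpowr (BVw_seminorm u) (1 / q) * ennpowr (BMO_norm u) (1 - 1 / q) = \<infinity>"
      by (simp add: b ennpowr_def ennreal_mult_eq_top_iff)
    thus ?thesis
      by simp
  next
    case 3
    with b K show ?thesis
      using besov_norm_le_finite_BVw_BMO[OF q meas, of a b]
      by (simp add: ennpowr_ennreal ennreal_mult)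
  qed
qed

lemma besov_space_if_BMO_BVw:
  fixes u :: "real ^ 'n \<Rightarrow> real"
  assumes q: "q > 1" and u: "u \<in> BMO" "u \<in> BVw"
  shows "u \<in> besov_space q"
proof -
  have "u \<in> Lp_space q"
    using q u by (intro Lp_space_if_weak_L1_BMO) (auto simp: BVw_def)
  moreover have "besov_norm q u < \<infinity>"
    by (rule le_less_trans[OF besov_norm_le_BVw_BMO[OF q u(1)]])
      (use u in \<open>auto simp: BMO_def BVw_def ennpowr_def ennreal_mult_less_top\<close>)
  ultimately show ?thesis
    by (simp add: besov_space_def)
qed

theorem theorem1p15:
  shows "(\<forall>q::real. 1 < q \<longrightarrow>
            (\<exists>C::real. C > 0 \<and>
              (\<forall>u :: real ^ 'n \<Rightarrow> real. u \<in> BMO \<longrightarrow>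
                 besov_norm q u
                   \<le> ennreal C * ennpowr (BVw_seminorm u) (1 / q) * ennpowr (BMO_norm u) (1 - 1 / q) \<and>
                 ennreal C * ennpowr (BVw_seminorm u) (1 / q) * ennpowr (BMO_norm u) (1 - 1 / q)
                   \<le> ennreal C * ennpowr (BV_norm u) (1 / q) * ennpowr (BMO_norm u) (1 - 1 / q)))) \<and>
         (\<forall>u :: real ^ 'n \<Rightarrow> real. u \<in> BMO \<inter> BVw \<longrightarrow>
            (\<forall>q::real. 1 < q \<longrightarrow> u \<in> besov_space q))"
proof (intro conjI allI impI)
  fix q :: real assume q: "1 < q"
  let ?C = "besov_interpolation_const q CARD('n)"
  let ?bound = "\<lambda>V u. ennreal ?C * ennpowr V (1 / q) * ennpowr (BMO_norm u) (1 - 1 / q)"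
  have "besov_norm q u \<le> ?bound (BVw_seminorm u) u \<and> ?bound (BVw_seminorm u) u \<le> ?bound (BV_norm u) u"
    if u: "u \<in> BMO" for u :: "real ^ 'n \<Rightarrow> real"
  proof
    show "besov_norm q u \<le> ?bound (BVw_seminorm u) u"
      using q u by (rule besov_norm_le_BVw_BMO)
    have "BVw_seminorm u \<le> BV_norm u"
      using u by (intro BVw_seminorm_le_BV_norm) (simp add: BMO_def L1_loc_def)
    with q show "?bound (BVw_seminorm u) u \<le> ?bound (BV_norm u) u"
      by (intro mult_right_mono mult_left_mono ennpowr_mono) auto
  qed
  with besov_interpolation_const_pos[OF q] show "\<exists>C>0. \<forall>u :: real ^ 'n \<Rightarrow> real. u \<in> BMO \<longrightarrow>
      besov_norm q u \<le> ennreal C * ennpowr (BVw_seminorm u) (1 / q) * ennpowr (BMO_norm u) (1 - 1 / q) \<and>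
      ennreal C * ennpowr (BVw_seminorm u) (1 / q) * ennpowr (BMO_norm u) (1 - 1 / q)
        \<le> ennreal C * ennpowr (BV_norm u) (1 / q) * ennpowr (BMO_norm u) (1 - 1 / q)"
    by (intro exI[of _ ?C]) simp
qed (use besov_space_if_BMO_BVw in blast)

end
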